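(* For odd positive coprime integers $a$ and $b$, the Jacobi symbol $\left(\frac{a}{b}\right)$ is given by $$\left(\frac{a}{b}\right) = (-1)^{\sum_{i=1}^{\frac{b-1}{2}} \left\lfloor \frac{ia}{b} \right\rfloor}.$$
   Context: $\lfloor x \rfloor$ denotes the greatest integer less than or equal to $x$; empty sums are $0$. For an odd prime $p$ and an integer $a$, the Legendre symbol $\left(\frac{a}{p}\right)$ is $0$ if $p$ divides $a$; otherwise it is $1$ if the congruence $x^2 \equiv a \pmod p$ has a solution and $-1$ if it has no solution. For an odd positive integer $b$ with prime factorization $b = p_1^{r_1} p_2^{r_2} \cdots p_k^{r_k}$, the Jacobi symbol is $\left(\frac{a}{b}\right) := \left(\frac{a}{p_1}\right)^{r_1} \left(\frac{a}{p_2}\right)^{r_2} \cdots \left(\frac{a}{p_k}\right)^{r_k}$, where $\left(\frac{a}{p_i}\right)$ is the Legendre symbol (the empty product, for $b=1$, is $1$). *)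

theory Defs
  imports Complex_Main "HOL-Number_Theory.Number_Theory"
begin

(* Intended for odd b > 0; the prime factors of an integer are its positive prime divisors. *)
definition Jacobi :: "int \<Rightarrow> int \<Rightarrow> int"
  where "Jacobi a b = (\<Prod>p\<in>prime_factors b. Legendre a p ^ multiplicity p b)"

end

theory Submission
  imports Defs
begin

text \<open>
  Both sides of the identity obey the same rules under the Euclidean algorithm, and these
  rules determine them. Write \<open>S(a, b)\<close> for the exponent, the sum of the \<open>\<lfloor>i a / b\<rfloor>\<close>
  over \<open>1 \<le> i \<le> (b - 1) / 2\<close>.

  The Jacobi symbol depends only on \<open>a\<close> modulo \<open>b\<close> (\<open>Jacobi_cong\<close>), gains the factor
  \<open>(-1) ^ ((b - 1) / 2)\<close> when \<open>a\<close> changes sign (\<open>Jacobi_minus\<close>), and is symmetric up to the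
  factor \<open>(-1) ^ ((a - 1) / 2 * ((b - 1) / 2))\<close> (\<open>Jacobi_reciprocity\<close>). The last two facts
  follow from the case of primes, because the symbol and the sign factors are both
  multiplicative.

  Modulo 2, the sum \<open>S\<close> behaves in the same way. It is unchanged when \<open>a\<close> moves by a multiple
  of \<open>2 b\<close> (\<open>parity_sign_half_floor_sum_cong\<close>); it gains \<open>(b - 1) / 2\<close> when \<open>a\<close> changes sign,
  since no \<open>i a / b\<close> is an integer (\<open>half_floor_sum_minus\<close>); and
  \<open>S(a, b) + S(b, a) = (a - 1) / 2 * ((b - 1) / 2)\<close> by Eisenstein's count of the lattice points
  on the two sides of a diagonal (\<open>half_floor_sum_reciprocity\<close>).

  If \<open>b > 1\<close>, an odd \<open>a\<close> coprime to \<open>b\<close> is congruent modulo \<open>2 b\<close> to an odd \<open>r\<close> with \<open>\<bar>r\<bar> < b\<close>; working modulo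
  \<open>2 b\<close> rather than \<open>b\<close> keeps every argument odd. Exchanging \<open>\<bar>r\<bar>\<close> and \<open>b\<close> then leads to
  a smaller lower argument, and the descent ends at \<open>b = 1\<close>, where both sides are 1.
\<close>

section \<open>Signs\<close>

text \<open>This is \<open>(-1) ^ n\<close> for exponents that may be negative, as floor sums for negative \<open>a\<close> are.\<close>

definition parity_sign :: "int \<Rightarrow> int"
  where "parity_sign n = (if even n then 1 else -1)"

lemma parity_sign_add: "parity_sign (m + n) = parity_sign m * parity_sign n"
  by (simp add: parity_sign_def)

lemma minus_one_power_nat: "n \<ge> 0 \<Longrightarrow> (-1) ^ nat n = parity_sign n"
  by (simp add: parity_sign_def minus_one_power_iff even_nat_iff)

text \<open>
  For odd \<open>x\<close> and \<open>y\<close>, \<open>x y - 1\<close> and \<open>(x - 1) + (y - 1)\<close> differ by \<open>(x - 1) (y - 1)\<close>, a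
  multiple of 4. This multiplicativity carries the sign laws from primes to products; the
  factor \<open>c\<close> makes the lemma serve both reciprocity and the symbol of \<open>-1\<close>.
\<close>

lemma parity_sign_half_pred_mult:
  fixes x y :: int
  assumes "odd x" "odd y"
  shows "parity_sign ((x * y - 1) div 2 * c) =
    parity_sign ((x - 1) div 2 * c) * parity_sign ((y - 1) div 2 * c)"
proof -
  obtain k l where "x = 2 * k + 1" "y = 2 * l + 1"
    using assms by (auto elim!: oddE)
  moreover from this have "x * y - 1 = 2 * (2 * k * l + k + l)"
    by (simp add: algebra_simps)
  ultimately show ?thesis
    by (auto simp: parity_sign_def)
qed

section \<open>Legendre symbol\<close>

lemma odd_prime_gt_2:
  fixes p :: int
  assumes "prime p" "odd p"
  shows "p > 2"
  using assms prime_ge_2_int[of p] by (cases "p = 2") auto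

lemma Legendre_values: "Legendre a p \<in> {-1, 0, 1}"
  by (simp add: Legendre_def)

lemma Legendre_cong:
  assumes "[a = a'] (mod p)"
  shows "Legendre a p = Legendre a' p"
proof -
  have "[a = 0] (mod p) \<longleftrightarrow> [a' = 0] (mod p)"
    using assms by (meson cong_sym cong_trans)
  moreover have "QuadRes p a \<longleftrightarrow> QuadRes p a'"
    unfolding QuadRes_def using assms by (meson cong_sym cong_trans)
  ultimately show ?thesis by (simp add: Legendre_def)
qed

lemma euler_criterion_int:
  fixes p :: int
  assumes "prime p" "odd p"
  shows "[Legendre a p = a ^ nat ((p - 1) div 2)] (mod p)"
proof -
  have "p > 2" using assms by (rule odd_prime_gt_2)
  then have "prime (nat p)" "2 < nat p" "int (nat p) = p" "(nat p - 1) div 2 = nat ((p - 1) div 2)"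
    using assms by (auto simp: nat_diff_distrib nat_div_distrib)
  then show ?thesis
    using euler_criterion[of "nat p" a] by simp
qed

text \<open>
  Euler's criterion determines Legendre symbols only modulo \<open>p\<close>; since \<open>p > 2\<close>, that is enough
  to tell \<open>-1\<close>, 0 and 1 apart.
\<close>

lemma sign_eqI:
  fixes s t p :: int
  assumes "s \<in> {-1, 0, 1}" "t \<in> {-1, 0, 1}" "p > 2" "[s = t] (mod p)"
  shows "s = t"
proof -
  have "p dvd s - t" using assms(4) by (simp add: cong_iff_dvd_diff)
  moreover have "\<bar>s - t\<bar> < p" using assms by auto
  ultimately show ?thesis
    using zdvd_not_zless[of "\<bar>s - t\<bar>" p] by (cases "s = t") auto
qed

lemma Legendre_mult:
  assumes "prime p" "odd p"
  shows "Legendre (a * b) p = Legendre a p * Legendre b p"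
proof (rule sign_eqI)
  show "p > 2" using assms by (rule odd_prime_gt_2)
  show "Legendre (a * b) p \<in> {-1, 0, 1}" by (rule Legendre_values)
  show "Legendre a p * Legendre b p \<in> {-1, 0, 1}"
    using Legendre_values[of a p] Legendre_values[of b p] by auto
  have "[Legendre (a * b) p = (a * b) ^ nat ((p - 1) div 2)] (mod p)"
    using assms by (rule euler_criterion_int)
  also have "(a * b) ^ nat ((p - 1) div 2) = a ^ nat ((p - 1) div 2) * b ^ nat ((p - 1) div 2)"
    by (rule power_mult_distrib)
  also have "[\<dots> = Legendre a p * Legendre b p] (mod p)"
    using assms by (intro cong_mult cong_sym[OF euler_criterion_int])
  finally show "[Legendre (a * b) p = Legendre a p * Legendre b p] (mod p)" .
qed

lemma Legendre_minus_one:
  assumes "prime p" "odd p"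
  shows "Legendre (-1) p = parity_sign ((p - 1) div 2)"
proof (rule sign_eqI)
  show "p > 2" using assms by (rule odd_prime_gt_2)
  then show "[Legendre (-1) p = parity_sign ((p - 1) div 2)] (mod p)"
    using euler_criterion_int[OF assms, of "-1"] by (simp add: minus_one_power_nat)
  show "Legendre (-1) p \<in> {-1, 0, 1}" by (rule Legendre_values)
qed (simp add: parity_sign_def)

text \<open>
  One symbol stands on each side so that the law includes the case \<open>p = q\<close>, where both symbols
  vanish. In this form it can be multiplied up over arbitrary prime factorizations.
\<close>

lemma Legendre_reciprocity:
  assumes "prime p" "odd p" "prime q" "odd q"
  shows "Legendre p q = Legendre q p * parity_sign ((p - 1) div 2 * ((q - 1) div 2))"
proof (cases "p = q")
  case True
  then show ?thesis by (simp add: Legendre_def cong_def)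
next
  case False
  have gt: "p > 2" "q > 2" using assms odd_prime_gt_2 by auto
  have nz: "Legendre q p \<in> {-1, 1}"
  proof -
    have "\<not> p dvd q" using assms False primes_dvd_imp_eq by blast
    then show ?thesis by (simp add: Legendre_def cong_0_iff)
  qed
  have "Legendre p q * Legendre q p = parity_sign ((p - 1) div 2 * ((q - 1) div 2))"
    using Quadratic_Reciprocity_int[of p q] assms gt False
    by (simp add: minus_one_power_nat)
  with nz show ?thesis by auto
qed

section \<open>Jacobi symbol\<close>

text \<open>
  As a product over the multiset of prime factors, the symbol inherits multiplicativity in the
  lower argument from the prime factorization.
\<close>

lemma Jacobi_prod_mset: "Jacobi a b = (\<Prod>p\<in>#prime_factorization b. Legendre a p)"
  unfolding Jacobi_def
  by (subst image_prod_mset_multiplicity)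
    (auto intro!: prod.cong simp: count_prime_factorization)

lemma Jacobi_1_right: "Jacobi a 1 = 1"
  by (simp add: Jacobi_prod_mset)

lemma Jacobi_prime: "prime p \<Longrightarrow> Jacobi a p = Legendre a p"
  by (simp add: Jacobi_prod_mset prime_factorization_prime)

lemma Jacobi_mult_right:
  assumes "b \<noteq> 0" "c \<noteq> 0"
  shows "Jacobi a (b * c) = Jacobi a b * Jacobi a c"
  using assms by (simp add: Jacobi_prod_mset prime_factorization_mult)

lemma Jacobi_cong:
  assumes "[a = a'] (mod b)"
  shows "Jacobi a b = Jacobi a' b"
  unfolding Jacobi_def
proof (intro prod.cong refl arg_cong2[where f = "(^)"] Legendre_cong)
  fix p assume "p \<in> prime_factors b"
  then show "[a = a'] (mod p)"
    using assms by (auto intro: cong_dvd_modulus)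
qed

lemma Jacobi_mult_left:
  assumes "odd b"
  shows "Jacobi (a * a') b = Jacobi a b * Jacobi a' b"
  unfolding Jacobi_def prod.distrib[symmetric] power_mult_distrib[symmetric]
proof (intro prod.cong refl arg_cong2[where f = "(^)"] Legendre_mult)
  fix p assume p: "p \<in> prime_factors b"
  then show "prime p" by auto
  from p have "p dvd b" by auto
  with assms show "odd p" using dvd_trans by blast
qed

lemma odd_pos_induct [consumes 2, case_names one mult]:
  fixes n :: int
  assumes "n > 0" "odd n"
    and one: "P 1"
    and mult: "\<And>p m. \<lbrakk>prime p; odd p; m > 0; odd m; P m\<rbrakk> \<Longrightarrow> P (p * m)"
  shows "P n"
proof -
  have "n > 0 \<longrightarrow> odd n \<longrightarrow> P n"
  proof (induction n rule: prime_divisors_induct)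
    case (unit x)
    then show ?case using one by auto
  next
    case (factor p x)
    then show ?case
      using mult[of p x] prime_gt_0_int[of p] by (auto simp: zero_less_mult_iff)
  qed simp
  with assms(1,2) show ?thesis by blast
qed

lemma Jacobi_minus_one:
  assumes "b > 0" "odd b"
  shows "Jacobi (-1) b = parity_sign ((b - 1) div 2)"
  using assms
proof (induction rule: odd_pos_induct)
  case one
  then show ?case by (simp add: Jacobi_1_right parity_sign_def)
next
  case (mult p m)
  then show ?case
    using parity_sign_half_pred_mult[of p m 1]
    by (auto simp: Jacobi_mult_right Jacobi_prime Legendre_minus_one)
qed

lemma Jacobi_minus:
  assumes "b > 0" "odd b"
  shows "Jacobi (- a) b = parity_sign ((b - 1) div 2) * Jacobi a b"
  using Jacobi_mult_left[of b "-1" a] assms by (simp add: Jacobi_minus_one)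

lemma Jacobi_1_left:
  assumes "odd b"
  shows "Jacobi 1 b = 1"
  unfolding Jacobi_def
proof (intro prod.neutral ballI)
  fix p assume "p \<in> prime_factors b"
  then have "\<not> p dvd 1" using not_prime_unit[of p] by auto
  then have "Legendre 1 p = 1"
    by (auto simp: Legendre_def cong_0_iff QuadRes_def intro: exI[of _ 1])
  then show "Legendre 1 p ^ multiplicity p b = 1" by simp
qed

text \<open>
  Reciprocity extends from primes in two steps: first the upper argument is built up from
  primes against a fixed prime \<open>q\<close>, then the lower argument against a fixed odd \<open>a\<close>.
\<close>

lemma Jacobi_prime_reciprocity:
  assumes "a > 0" "odd a" "prime q" "odd q"
  shows "Jacobi a q = Jacobi q a * parity_sign ((a - 1) div 2 * ((q - 1) div 2))"
  using assms(1,2)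
proof (induction rule: odd_pos_induct)
  case one
  then show ?case
    using assms by (simp add: Jacobi_1_right Jacobi_1_left parity_sign_def)
next
  case (mult p m)
  have "Jacobi (p * m) q = Legendre p q * Jacobi m q"
    using assms by (simp add: Legendre_mult Jacobi_prime)
  also have "Legendre p q = Jacobi q p * parity_sign ((p - 1) div 2 * ((q - 1) div 2))"
    using mult assms Legendre_reciprocity[of p q] by (simp add: Jacobi_prime)
  finally show ?case
    using mult by (auto simp: parity_sign_half_pred_mult Jacobi_mult_right)
qed

lemma Jacobi_reciprocity:
  assumes "a > 0" "odd a" "b > 0" "odd b"
  shows "Jacobi a b = Jacobi b a * parity_sign ((b - 1) div 2 * ((a - 1) div 2))"
  using assms(3,4)
proof (induction rule: odd_pos_induct)
  case one
  then show ?case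
    using assms by (simp add: Jacobi_1_right Jacobi_1_left parity_sign_def)
next
  case (mult p m)
  have "Jacobi a (p * m) = Jacobi a p * Jacobi a m"
    using mult by (intro Jacobi_mult_right) auto
  also have "Jacobi a p = Jacobi p a * parity_sign ((p - 1) div 2 * ((a - 1) div 2))"
    using mult assms Jacobi_prime_reciprocity[of a p] by (simp add: mult.commute)
  finally show ?case
    using mult assms by (auto simp: parity_sign_half_pred_mult Jacobi_mult_left)
qed

section \<open>Floor sum\<close>

definition half_floor_sum :: "int \<Rightarrow> int \<Rightarrow> int"
  where "half_floor_sum a b = (\<Sum>i = 1..(b - 1) div 2. i * a div b)"

lemma not_dvd_half_range:
  fixes a b i :: int
  assumes "coprime a b" "i \<in> {1..(b - 1) div 2}"
  shows "\<not> b dvd i * a"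
proof
  assume "b dvd i * a"
  then have "b dvd i"
    using assms(1) by (simp add: coprime_dvd_mult_left_iff coprime_commute)
  then show False using assms(2) zdvd_imp_le[of b i] by auto
qed

text \<open>
  Adding \<open>2 b k\<close> to \<open>a\<close> adds the even number \<open>2 i k\<close> to each term. A shift by an odd multiple
  of \<open>b\<close> may change the parity, so the modulus \<open>2 b\<close> cannot be replaced by \<open>b\<close>.
\<close>

lemma parity_sign_half_floor_sum_cong:
  assumes "[a = a'] (mod 2 * b)"
  shows "parity_sign (half_floor_sum a b) = parity_sign (half_floor_sum a' b)"
proof (cases "b = 0")
  case False
  obtain k where k: "a' = a + 2 * b * k"
    using assms by (metis cong_iff_lin)
  have "i * a' div b = i * a div b + 2 * (i * k)" for i
  proof -
    have "i * a' = i * a + (2 * (i * k)) * b" by (simp add: k algebra_simps)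
    then show ?thesis using False by simp
  qed
  then have "half_floor_sum a' b = half_floor_sum a b + 2 * (\<Sum>i = 1..(b - 1) div 2. i * k)"
    by (simp add: half_floor_sum_def sum.distrib sum_distrib_left)
  then show ?thesis by (simp add: parity_sign_def)
qed (simp add: half_floor_sum_def)

text \<open>\<open>\<lfloor>-x\<rfloor> = -\<lfloor>x\<rfloor> - 1\<close> for every \<open>x\<close> that is not an integer.\<close>

lemma half_floor_sum_minus:
  assumes "coprime a b" "b > 0"
  shows "half_floor_sum (- a) b = - (half_floor_sum a b + (b - 1) div 2)"
proof -
  have "i * (- a) div b = - (i * a div b) - 1" if "i \<in> {1..(b - 1) div 2}" for i
    using not_dvd_half_range[OF assms(1) that] zdiv_zminus1_eq_if[of b "i * a"] assms(2)
    by (simp add: dvd_eq_mod_eq_0)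
  then have "half_floor_sum (- a) b = (\<Sum>i = 1..(b - 1) div 2. - (i * a div b) - 1)"
    unfolding half_floor_sum_def by (intro sum.cong refl)
  then show ?thesis
    using assms(2) by (simp add: half_floor_sum_def sum_subtractf sum_negf)
qed

text \<open>
  The floor counts the \<open>j \<ge> 1\<close> with \<open>j < i a / b\<close>. As \<open>i < b / 2\<close>, all of them lie below
  \<open>a / 2\<close>, so the range of \<open>j\<close> can be cut at \<open>(a - 1) / 2\<close> whatever \<open>i\<close> is; this is what
  makes the two double sums of the reciprocity law run over the same rectangle.
\<close>

lemma floor_as_count:
  fixes a b i :: int
  assumes "a > 0" "odd a" "b > 0" "coprime a b" and i: "i \<in> {1..(b - 1) div 2}"
  shows "i * a div b = (\<Sum>j = 1..(a - 1) div 2. of_bool (j * b < i * a))"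
proof -
  have "{j \<in> {1..(a - 1) div 2}. j * b < i * a} = {1..i * a div b}"
  proof (intro equalityI subsetI)
    fix j assume "j \<in> {j \<in> {1..(a - 1) div 2}. j * b < i * a}"
    then have "1 \<le> j" "j * b \<le> i * a" by auto
    then show "j \<in> {1..i * a div b}"
      using zdiv_mono1[of "j * b" "i * a" b] assms by simp
  next
    fix j assume j: "j \<in> {1..i * a div b}"
    have "j * b \<le> (i * a div b) * b" using j assms by (intro mult_right_mono) auto
    also have "\<dots> \<le> i * a"
      using assms div_mult_mod_eq[of "i * a" b] pos_mod_sign[of b "i * a"] by linarith
    finally have le: "j * b \<le> i * a" .
    moreover have "j * b \<noteq> i * a"
      using not_dvd_half_range[OF assms(4) i] by (metis dvd_triv_right)
    moreover have "j \<le> (a - 1) div 2"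
    proof -
      have "2 * i < b" using i by auto
      then have "2 * i * a < b * a" using assms by simp
      with le have "b * (2 * j) < b * a" by (simp add: mult_ac)
      then have "2 * j < a" using assms by simp
      then show ?thesis by linarith
    qed
    ultimately show "j \<in> {j \<in> {1..(a - 1) div 2}. j * b < i * a}" using j by auto
  qed
  moreover have "i * a div b \<ge> 0"
    using i assms by (simp add: pos_imp_zdiv_nonneg_iff)
  ultimately show ?thesis
    by (simp add: of_bool_def sum.If_cases Int_def)
qed

text \<open>
  The two sums count the points \<open>(i, j)\<close> of a rectangle below and above the line
  \<open>j b = i a\<close>, which by coprimality contains none of these points.
\<close>

lemma half_floor_sum_reciprocity:
  assumes "a > 0" "odd a" "b > 0" "odd b" "coprime a b"
  shows "half_floor_sum a b + half_floor_sum b a = (b - 1) div 2 * ((a - 1) div 2)"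
proof -
  let ?A = "{1..(a - 1) div 2}" and ?B = "{1..(b - 1) div 2}"
  have "half_floor_sum a b = (\<Sum>i\<in>?B. \<Sum>j\<in>?A. of_bool (j * b < i * a))"
    unfolding half_floor_sum_def using assms by (intro sum.cong refl floor_as_count)
  moreover have "half_floor_sum b a = (\<Sum>j\<in>?A. \<Sum>i\<in>?B. of_bool (i * a < j * b))"
    unfolding half_floor_sum_def
    using assms by (intro sum.cong refl floor_as_count) (auto simp: coprime_commute)
  then have "half_floor_sum b a = (\<Sum>i\<in>?B. \<Sum>j\<in>?A. of_bool (i * a < j * b))"
    by (simp only: sum.swap[of _ ?A ?B])
  ultimately have "half_floor_sum a b + half_floor_sum b a =
      (\<Sum>i\<in>?B. \<Sum>j\<in>?A. of_bool (j * b < i * a) + of_bool (i * a < j * b))"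
    by (simp only: sum.distrib)
  also have "\<dots> = (\<Sum>i\<in>?B. \<Sum>j\<in>?A. 1)"
  proof (intro sum.cong refl)
    fix i j assume "i \<in> ?B" "j \<in> ?A"
    then have "i * a \<noteq> j * b"
      using not_dvd_half_range[OF assms(5)] by (metis dvd_triv_right)
    then show "of_bool (j * b < i * a) + of_bool (i * a < j * b) = (1 :: int)"
      by auto
  qed
  also have "\<dots> = (b - 1) div 2 * ((a - 1) div 2)"
    using assms by simp
  finally show ?thesis .
qed

section \<open>Euclidean descent\<close>

text \<open>
  Strong induction on \<open>b\<close>. Negative \<open>a\<close> are allowed because the odd representative of
  least absolute value modulo \<open>2 b\<close> may be negative.
\<close>

lemma Jacobi_eq_parity_sign_half_floor_sum:
  assumes "odd a" "b > 0" "odd b" "coprime a b"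
  shows "Jacobi a b = parity_sign (half_floor_sum a b)"
  using assms
proof (induction "nat b" arbitrary: a b rule: less_induct)
  case less
  show ?case
  proof (cases "b = 1")
    case True
    then show ?thesis by (simp add: Jacobi_1_right half_floor_sum_def parity_sign_def)
  next
    case False
    with less.prems have "b > 1" by simp
    \<comment> \<open>Reciprocity turns \<open>(c, b)\<close> into \<open>(b, c)\<close>, to which the induction hypothesis applies.\<close>
    have pos: "Jacobi c b = parity_sign (half_floor_sum c b)"
      if c: "0 < c" "c < b" "odd c" "coprime c b" for c
    proof -
      let ?e = "(b - 1) div 2 * ((c - 1) div 2)"
      have "Jacobi c b = Jacobi b c * parity_sign ?e"
        using c less.prems by (intro Jacobi_reciprocity) auto
      also have "Jacobi b c = parity_sign (half_floor_sum b c)"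
        using c less.prems by (intro less.hyps) (auto simp: coprime_commute)
      also have "\<dots> * parity_sign ?e = parity_sign (half_floor_sum b c + ?e)"
        by (simp add: parity_sign_add)
      also have "\<dots> = parity_sign (half_floor_sum c b + 2 * half_floor_sum b c)"
        using half_floor_sum_reciprocity[of c b] c less.prems
        by (intro arg_cong[where f = parity_sign]) simp
      also have "\<dots> = parity_sign (half_floor_sum c b)"
        by (simp add: parity_sign_def)
      finally show ?thesis .
    qed
    \<comment> \<open>Shifting by the odd number \<open>b\<close> puts \<open>r\<close> between \<open>-b\<close> and \<open>b\<close> and makes the
      remainder even, hence \<open>r\<close> odd; the endpoint \<open>-b\<close> is excluded by coprimality.\<close>
    define r where "r = (a + b) mod (2 * b) - b"
    have cong: "[a = r] (mod 2 * b)"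
      by (simp add: r_def cong_def mod_diff_left_eq)
    then have cong_b: "[a = r] (mod b)"
      by (rule cong_dvd_modulus) simp
    have "even ((a + b) mod (2 * b))"
      using less.prems by (simp add: dvd_mod_iff)
    with less.prems have "odd r" by (simp add: r_def)
    have "coprime r b"
      using cong_b less.prems(4) cong_imp_coprime by blast
    have "r \<ge> - b" "r < b"
      using \<open>b > 1\<close> pos_mod_bound[of "2 * b" "a + b"] by (auto simp: r_def)
    moreover have "r \<noteq> - b"
      using \<open>coprime r b\<close> \<open>b > 1\<close> by auto
    ultimately have r: "- b < r" "r < b" by auto
    have "Jacobi r b = parity_sign (half_floor_sum r b)"
    proof (cases "r > 0")
      case True
      with r \<open>odd r\<close> \<open>coprime r b\<close> show ?thesis by (intro pos)
    next
      case False
      with \<open>odd r\<close> have "r < 0" by (cases "r = 0") auto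
      have "Jacobi r b = parity_sign ((b - 1) div 2) * Jacobi (- r) b"
        using Jacobi_minus[of b "- r"] less.prems by simp
      also have "Jacobi (- r) b = parity_sign (half_floor_sum (- r) b)"
        using r \<open>r < 0\<close> \<open>odd r\<close> \<open>coprime r b\<close> by (intro pos) auto
      also have "parity_sign ((b - 1) div 2) * \<dots> = parity_sign (half_floor_sum r b)"
        using half_floor_sum_minus[of "- r" b] \<open>coprime r b\<close> less.prems
        by (simp add: parity_sign_def)
      finally show ?thesis .
    qed
    then show ?thesis
      using Jacobi_cong[OF cong_b] parity_sign_half_floor_sum_cong[OF cong] by simp
  qed
qed

theorem theorem12:
  fixes a b :: int
  assumes "a > 0" and "b > 0" and "odd a" and "odd b" and "coprime a b"
  shows "Jacobi a b =
    (-1) ^ nat (\<Sum>i = 1..(b - 1) div 2. \<lfloor>real_of_int (i * a) / real_of_int b\<rfloor>)"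
proof -
  have "(\<Sum>i = 1..(b - 1) div 2. \<lfloor>real_of_int (i * a) / real_of_int b\<rfloor>) = half_floor_sum a b"
    unfolding half_floor_sum_def floor_divide_of_int_eq ..
  moreover have "half_floor_sum a b \<ge> 0"
    unfolding half_floor_sum_def using assms
    by (intro sum_nonneg) (simp add: pos_imp_zdiv_nonneg_iff)
  ultimately show ?thesis
    using assms Jacobi_eq_parity_sign_half_floor_sum[of a b] by (simp add: minus_one_power_nat)
qed

end
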